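(* Let $P$ be a dcpo satisfying property $M$ and such that every element of $P$ is the supremum of a directed set of quasicontinuous elements of $P$. Then $P$ is SCL-faithful.
   Context: A dcpo is a poset in which every (nonempty) directed subset has a supremum. A subset $A$ of a dcpo $P$ is Scott closed if it is a lower set and $\bigvee D\in A$ for every directed $D\subseteq A$. $C_\sigma(P)$ is the lattice of all Scott closed subsets of $P$ ordered by inclusion. A dcpo $P$ is SCL-faithful if for every dcpo $Q$, $C_\sigma(P)\cong C_\sigma(Q)$ (as lattices) implies $P\cong Q$ (as posets). For a finite subset $A$ of a poset $P$, $mub(A)$ denotes the set of minimal upper bounds of $A$; it is complete if for every upper bound $x$ of $A$ there is $y\in mub(A)$ with $y\le x$. $P$ satisfies property $m$ if $mub(A)$ is complete for every finite $A\subseteq P$. $P$ satisfies property $M$ if it satisfies property $m$ and $mub(A)$ is finite for every finite $A\subseteq P$. A finite subset $F$ of a dcpo $R$ is way-below $a\in R$, written $F\ll a$, if for every directed $D\subseteq R$, $a\le\bigvee D$ implies $D\cap{\uparrow}F\neq\emptyset$, where ${\uparrow}F=\{x: y\le x\text{ for some }y\in F\}$. Let $fin(x)=\{F: F\text{ finite and }F\ll x\}$. A dcpo $R$ is quasicontinuous if for every $x\in R$ the family $fin(x)$ is directed (it is nonempty, and for all $F_1,F_2\in fin(x)$ there is $F\in fin(x)$ with $F\subseteq{\uparrow}F_1\cap{\uparrow}F_2$) and for every $y$ with $x\not\le y$ there is $F\in fin(x)$ with $y\notin{\uparrow}F$. An element $x$ of a dcpo $P$ is quasicontinuous if the sub-dcpo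 ${\downarrow}x=\{z\in P: z\le x\}$ is a quasicontinuous dcpo. *)

theory Defs
  imports "HOL-Algebra.Complete_Lattice"
begin

text \<open>
  Posets are HOL-Algebra orders (locale \<^locale>\<open>partial_order\<close>), so the carrier is a set which
  may be empty.
\<close>

definition directed :: "('a, 'm) gorder_scheme \<Rightarrow> 'a set \<Rightarrow> bool" where
  "directed P D \<longleftrightarrow> D \<subseteq> carrier P \<and> D \<noteq> {} \<and>
     (\<forall>x\<in>D. \<forall>y\<in>D. \<exists>z\<in>D. x \<sqsubseteq>\<^bsub>P\<^esub> z \<and> y \<sqsubseteq>\<^bsub>P\<^esub> z)"

locale dcpo = partial_order P for P :: "('a, 'm) gorder_scheme" (structure) +
  assumes directed_lub_exists: "directed P D \<Longrightarrow> \<exists>s. is_lub P s D"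

definition scott_closed :: "('a, 'm) gorder_scheme \<Rightarrow> 'a set \<Rightarrow> bool" where
  "scott_closed P A \<longleftrightarrow> A \<subseteq> carrier P \<and>
     (\<forall>x\<in>A. \<forall>y\<in>carrier P. y \<sqsubseteq>\<^bsub>P\<^esub> x \<longrightarrow> y \<in> A) \<and>
     (\<forall>D s. directed P D \<and> D \<subseteq> A \<and> is_lub P s D \<longrightarrow> s \<in> A)"

lemma scott_closed_lub:
  assumes A: "scott_closed P A" and D: "directed P D" "D \<subseteq> A" "is_lub P s D"
  shows "s \<in> A"
proof -
  have "\<forall>D s. directed P D \<and> D \<subseteq> A \<and> is_lub P s D \<longrightarrow> s \<in> A"
    using A unfolding scott_closed_def by (elim conjE)
  from this[rule_format, OF conjI[OF D(1) conjI[OF D(2,3)]]] show ?thesis .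
qed

definition scott_closed_lattice :: "('a, 'm) gorder_scheme \<Rightarrow> 'a set gorder" where
  "scott_closed_lattice P = \<lparr>carrier = {A. scott_closed P A}, eq = (=), le = (\<subseteq>)\<rparr>"

text \<open>Joins and meets in the lattice of Scott closed sets are unions and intersections.\<close>

lemma (in dcpo) scott_closed_Un:
  assumes A: "scott_closed P A" and B: "scott_closed P B"
  shows "scott_closed P (A \<union> B)"
  unfolding scott_closed_def
proof (intro conjI allI impI ballI)
  show "A \<union> B \<subseteq> carrier P" using A B by (auto simp: scott_closed_def)
next
  fix x y assume "x \<in> A \<union> B" "y \<in> carrier P" "y \<sqsubseteq> x"
  then show "y \<in> A \<union> B" using A B unfolding scott_closed_def by blast
next
  fix D s assume D: "directed P D \<and> D \<subseteq> A \<union> B \<and> is_lub P s D"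
  have sub: "D \<subseteq> carrier P" using D by (simp add: directed_def)
  have D_split: "D \<subseteq> A \<or> D \<subseteq> B"
  proof (rule ccontr)
    assume "\<not> (D \<subseteq> A \<or> D \<subseteq> B)"
    then obtain a b where ab: "a \<in> D" "a \<notin> A" "b \<in> D" "b \<notin> B" by blast
    obtain z where z: "z \<in> D" "a \<sqsubseteq> z" "b \<sqsubseteq> z"
      using D ab(1,3) unfolding directed_def by blast
    have lower: "a \<in> C" if "scott_closed P C" "z \<in> C" "a \<in> D" "a \<sqsubseteq> z" for C a
      using that sub unfolding scott_closed_def by (meson subsetD)
    have "z \<in> A \<or> z \<in> B" using D z(1) by blast
    then show False
      using lower[OF A _ ab(1) z(2)] lower[OF B _ ab(3) z(3)] ab(2,4) by blast
  qed
  then show "s \<in> A \<union> B"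
    using D scott_closed_lub[OF A, of D s] scott_closed_lub[OF B, of D s] by blast
qed

lemma scott_closed_Int:
  assumes A: "scott_closed P A" and B: "scott_closed P B"
  shows "scott_closed P (A \<inter> B)"
  unfolding scott_closed_def
proof (intro conjI allI impI ballI)
  show "A \<inter> B \<subseteq> carrier P" using A by (auto simp: scott_closed_def)
next
  fix x y assume "x \<in> A \<inter> B" "y \<in> carrier P" "y \<sqsubseteq>\<^bsub>P\<^esub> x"
  then show "y \<in> A \<inter> B" using A B unfolding scott_closed_def by blast
next
  fix D s assume "directed P D \<and> D \<subseteq> A \<inter> B \<and> is_lub P s D"
  then show "s \<in> A \<inter> B"
    using scott_closed_lub[OF A, of D s] scott_closed_lub[OF B, of D s] by blast
qed

lemma partial_order_scott_closed_lattice: "partial_order (scott_closed_lattice P)"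
  by unfold_locales (auto simp: scott_closed_lattice_def)

lemma (in dcpo) join_scott_closed_lattice:
  assumes "scott_closed P A" "scott_closed P B"
  shows "A \<squnion>\<^bsub>scott_closed_lattice P\<^esub> B = A \<union> B"
proof -
  interpret C: partial_order "scott_closed_lattice P"
    by (rule partial_order_scott_closed_lattice)
  have lub: "is_lub (scott_closed_lattice P) (A \<union> B) {A, B}"
    using assms scott_closed_Un
    by (intro least_UpperI) (auto simp: scott_closed_lattice_def Upper_def)
  show ?thesis
    unfolding join_def sup_def
    by (rule some_equality[where P = "\<lambda>x. is_lub (scott_closed_lattice P) x {A, B}"])
      (rule lub, rule C.least_unique[OF _ lub])
qed

lemma meet_scott_closed_lattice:
  assumes "scott_closed P A" "scott_closed P B"
  shows "A \<sqinter>\<^bsub>scott_closed_lattice P\<^esub> B = A \<inter> B"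
proof -
  interpret C: partial_order "scott_closed_lattice P"
    by (rule partial_order_scott_closed_lattice)
  have glb: "is_glb (scott_closed_lattice P) (A \<inter> B) {A, B}"
    using assms scott_closed_Int[of P A B]
    by (intro greatest_LowerI) (auto simp: scott_closed_lattice_def Lower_def)
  show ?thesis
    unfolding meet_def inf_def
    by (rule some_equality[where P = "\<lambda>x. is_glb (scott_closed_lattice P) x {A, B}"])
      (rule glb, rule C.greatest_unique[OF _ glb])
qed

definition order_isomorphic :: "('a, 'm) gorder_scheme \<Rightarrow> ('b, 'n) gorder_scheme \<Rightarrow> bool" where
  "order_isomorphic P Q \<longleftrightarrow>
     (\<exists>f. bij_betw f (carrier P) (carrier Q) \<and> order_emb P Q f)"

definition lattice_isomorphic :: "('a, 'm) gorder_scheme \<Rightarrow> ('b, 'n) gorder_scheme \<Rightarrow> bool" where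
  "lattice_isomorphic L M \<longleftrightarrow>
     (\<exists>f. bij_betw f (carrier L) (carrier M) \<and>
        (\<forall>x\<in>carrier L. \<forall>y\<in>carrier L.
           f (x \<squnion>\<^bsub>L\<^esub> y) = f x \<squnion>\<^bsub>M\<^esub> f y \<and> f (x \<sqinter>\<^bsub>L\<^esub> y) = f x \<sqinter>\<^bsub>M\<^esub> f y))"

text \<open>
  HOL cannot quantify over types inside a formula, so the type \<open>'b\<close> of the elements of the
  competing dcpo \<open>Q\<close> is an argument; faithfulness of \<open>P\<close> is this predicate for every type \<open>'b\<close>.
  (The instance with \<open>'b\<close> the type of sets over the element type of \<open>P\<close> already covers all \<open>Q\<close>
  up to isomorphism: \<open>Q\<close> embeds, by principal ideals, into its lattice of Scott closed sets.)
\<close>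

definition SCL_faithful :: "'b itself \<Rightarrow> ('a, 'm) gorder_scheme \<Rightarrow> bool" where
  "SCL_faithful (T :: 'b itself) P \<longleftrightarrow>
     (\<forall>Q :: 'b gorder. dcpo Q \<longrightarrow>
        lattice_isomorphic (scott_closed_lattice P) (scott_closed_lattice Q) \<longrightarrow>
        order_isomorphic P Q)"

definition mub :: "('a, 'm) gorder_scheme \<Rightarrow> 'a set \<Rightarrow> 'a set" where
  "mub P A = {u \<in> Upper P A. \<forall>v\<in>Upper P A. v \<sqsubseteq>\<^bsub>P\<^esub> u \<longrightarrow> v = u}"

definition mub_complete :: "('a, 'm) gorder_scheme \<Rightarrow> 'a set \<Rightarrow> bool" where
  "mub_complete P A \<longleftrightarrow> (\<forall>x\<in>Upper P A. \<exists>y\<in>mub P A. y \<sqsubseteq>\<^bsub>P\<^esub> x)"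

text \<open>
  The empty set counts as a finite subset: its upper bounds are all elements, so \<open>mub P {}\<close> is
  the set of minimal elements of \<open>P\<close>.
\<close>

definition property_m :: "('a, 'm) gorder_scheme \<Rightarrow> bool" where
  "property_m P \<longleftrightarrow> (\<forall>A. finite A \<and> A \<subseteq> carrier P \<longrightarrow> mub_complete P A)"

definition property_M :: "('a, 'm) gorder_scheme \<Rightarrow> bool" where
  "property_M P \<longleftrightarrow> property_m P \<and> (\<forall>A. finite A \<and> A \<subseteq> carrier P \<longrightarrow> finite (mub P A))"

definition up_set :: "('a, 'm) gorder_scheme \<Rightarrow> 'a set \<Rightarrow> 'a set" where
  "up_set P F = {x \<in> carrier P. \<exists>y\<in>F. y \<sqsubseteq>\<^bsub>P\<^esub> x}"

definition way_below :: "('a, 'm) gorder_scheme \<Rightarrow> 'a set \<Rightarrow> 'a \<Rightarrow> bool" where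
  "way_below R F a \<longleftrightarrow>
     (\<forall>D s. directed R D \<and> is_lub R s D \<and> a \<sqsubseteq>\<^bsub>R\<^esub> s \<longrightarrow> D \<inter> up_set R F \<noteq> {})"

definition fin_below :: "('a, 'm) gorder_scheme \<Rightarrow> 'a \<Rightarrow> 'a set set" where
  "fin_below R x = {F. finite F \<and> F \<subseteq> carrier R \<and> way_below R F x}"

definition quasicontinuous_dcpo :: "('a, 'm) gorder_scheme \<Rightarrow> bool" where
  "quasicontinuous_dcpo R \<longleftrightarrow> dcpo R \<and>
     (\<forall>x\<in>carrier R.
        fin_below R x \<noteq> {} \<and>
        (\<forall>F1\<in>fin_below R x. \<forall>F2\<in>fin_below R x.
           \<exists>F\<in>fin_below R x. F \<subseteq> up_set R F1 \<inter> up_set R F2) \<and>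
        (\<forall>y\<in>carrier R. \<not> x \<sqsubseteq>\<^bsub>R\<^esub> y \<longrightarrow> (\<exists>F\<in>fin_below R x. y \<notin> up_set R F)))"

definition principal_ideal :: "('a, 'm) gorder_scheme \<Rightarrow> 'a \<Rightarrow> ('a, 'm) gorder_scheme" where
  "principal_ideal P x = P\<lparr>carrier := {z \<in> carrier P. z \<sqsubseteq>\<^bsub>P\<^esub> x}\<rparr>"

lemma (in dcpo) dcpo_principal_ideal:
  assumes x: "x \<in> carrier P"
  shows "dcpo (principal_ideal P x)"
proof -
  let ?I = "principal_ideal P x"
  have weak: "weak_partial_order ?I"
    unfolding principal_ideal_def
    by (rule weak_partial_order_subset[OF weak_partial_order_axioms]) auto
  show ?thesis
  proof (intro dcpo.intro partial_order.intro weak)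
    show "partial_order_axioms ?I"
      by unfold_locales (simp add: principal_ideal_def eq_is_equal)
    show "dcpo_axioms ?I"
    proof
      fix D assume D: "directed ?I D"
      then have D': "directed P D" and below: "\<And>d. d \<in> D \<Longrightarrow> d \<sqsubseteq> x"
        unfolding directed_def principal_ideal_def by auto
      then have sub: "D \<subseteq> carrier P" by (simp add: directed_def)
      obtain s where s: "is_lub P s D" using directed_lub_exists[OF D'] by blast
      have s_le: "s \<sqsubseteq> y" if "y \<in> carrier P" "\<And>d. d \<in> D \<Longrightarrow> d \<sqsubseteq> y" for y
        by (rule least_le[OF s]) (simp add: Upper_def that)
      have s_ub: "s \<in> carrier P" "\<And>d. d \<in> D \<Longrightarrow> d \<sqsubseteq> s"
        using s sub by (auto intro: least_Upper_above)
      have "is_lub ?I s D"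
      proof (rule least_UpperI)
        show "D \<subseteq> carrier ?I" using D by (simp add: directed_def)
        show "s \<in> carrier ?I" by (simp add: principal_ideal_def s_ub s_le x below)
        show "d \<sqsubseteq>\<^bsub>?I\<^esub> s" if "d \<in> D" for d
          using s_ub(2)[OF that] by (simp add: principal_ideal_def)
        show "s \<sqsubseteq>\<^bsub>?I\<^esub> y" if "y \<in> Upper ?I D" for y
          using that sub below by (auto simp: principal_ideal_def Upper_def intro!: s_le)
      qed
      then show "\<exists>s. is_lub ?I s D" ..
    qed
  qed
qed

definition quasicontinuous_element :: "('a, 'm) gorder_scheme \<Rightarrow> 'a \<Rightarrow> bool" where
  "quasicontinuous_element P x \<longleftrightarrow> x \<in> carrier P \<and> quasicontinuous_dcpo (principal_ideal P x)"

end

theory Submission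
  imports Defs
begin

text \<open>
  Write \<open>C(P)\<close> for the lattice of Scott closed sets of \<open>P\<close> and \<open>down P x\<close> for the principal ideal of
  \<open>x\<close>. An isomorphism \<open>h\<close> from \<open>C(Q)\<close> to \<open>C(P)\<close> yields an isomorphism of \<open>Q\<close> with \<open>P\<close> as soon as
  it maps principal ideals exactly onto principal ideals. The two hypotheses on \<open>P\<close> give the two
  halves of this.

  Property \<open>M\<close> makes every \<open>h (down Q q)\<close> principal. The link is an order-theoretic property of
  principal ideals, called \<open>C_compact\<close> here: if \<open>down Q q\<close> lies below the supremum of a family of
  closed sets, and this family is itself Scott closed in \<open>C(Q)\<close>, then \<open>down Q q\<close> is a member of
  the family. Isomorphisms preserve it. Let \<open>A\<close> be a closed set of \<open>P\<close> with this property,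
  and consider the closed subsets of \<open>A\<close> in which any two points have an upper bound in \<open>A\<close>. The
  supremum of this family is \<open>A\<close>, as it contains the principal ideals of the points of \<open>A\<close>. If the
  family is Scott closed, then \<open>A\<close> belongs to it, so \<open>A\<close> is directed and is the principal ideal of
  its own supremum. Closure of the family reduces to closure of the sets
  \<open>{b. b and c have an upper bound in A}\<close>, which is what property \<open>M\<close> provides: along a directed
  set \<open>D\<close> the finite sets of minimal upper bounds of \<open>{d, c}\<close> form a filtered family, and Rudin's
  lemma selects a directed subset of \<open>A\<close> whose supremum bounds \<open>D\<close> and \<open>c\<close>
  (\<open>scott_closed_compatible\<close>, \<open>C_compact_imp_principal\<close>).

  So \<open>h (down Q q) = down P (g q)\<close> for an order embedding \<open>g\<close> whose image \<open>S\<close> is closed under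
  directed suprema. Since \<open>h\<close> is an order isomorphism, \<open>S\<close> is \<open>very_dense\<close>: for Scott
  closed \<open>A\<close> and \<open>B\<close> it meets \<open>A - B\<close> unless \<open>A\<close> is contained in \<open>B\<close>. It remains to see that \<open>S\<close> is everything,
  and by the second hypothesis it suffices that \<open>S\<close> contains every quasicontinuous element \<open>x\<close>
  (\<open>quasicontinuous_element_mem\<close>). In \<open>down P x\<close> each finite set way below \<open>x\<close> can be interpolated,
  and by very density the interpolating points can be replaced by points of \<open>S\<close> below them. Thus the
  finite subsets of \<open>S\<close> that are way below \<open>x\<close> still determine \<open>x\<close>, and Rudin's lemma extracts from
  them a directed subset of \<open>S\<close> with supremum \<open>x\<close>.
\<close>


section \<open>Bounds and principal ideals\<close>

lemma is_lub_iff: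
  assumes "A \<subseteq> carrier P"
  shows "is_lub P s A \<longleftrightarrow> s \<in> carrier P \<and> (\<forall>a\<in>A. a \<sqsubseteq>\<^bsub>P\<^esub> s) \<and>
    (\<forall>y\<in>carrier P. (\<forall>a\<in>A. a \<sqsubseteq>\<^bsub>P\<^esub> y) \<longrightarrow> s \<sqsubseteq>\<^bsub>P\<^esub> y)"
  using assms unfolding least_def Upper_def by blast

definition down :: "('a, 'm) gorder_scheme \<Rightarrow> 'a \<Rightarrow> 'a set" where
  "down P x = {z \<in> carrier P. z \<sqsubseteq>\<^bsub>P\<^esub> x}"

lemma carrier_principal_ideal [simp]: "carrier (principal_ideal P x) = down P x"
  by (simp add: principal_ideal_def down_def)

lemma le_principal_ideal [simp]: "le (principal_ideal P x) = le P"
  by (simp add: principal_ideal_def)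

lemma directed_carrier: "directed P D \<Longrightarrow> D \<subseteq> carrier P"
  by (simp add: directed_def)

lemma directedE:
  assumes "directed P D" "x \<in> D" "y \<in> D"
  obtains z where "z \<in> D" "x \<sqsubseteq>\<^bsub>P\<^esub> z" "y \<sqsubseteq>\<^bsub>P\<^esub> z"
proof -
  have "\<forall>x\<in>D. \<forall>y\<in>D. \<exists>z\<in>D. x \<sqsubseteq>\<^bsub>P\<^esub> z \<and> y \<sqsubseteq>\<^bsub>P\<^esub> z"
    using assms(1) by (simp add: directed_def)
  from bspec[OF bspec[OF this assms(2)] assms(3)] show ?thesis using that by blast
qed

lemma directed_principal_ideal_iff:
  "directed (principal_ideal P x) D \<longleftrightarrow> directed P D \<and> D \<subseteq> down P x"
  by (auto simp: directed_def down_def)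

lemma scott_closedI:
  assumes "A \<subseteq> carrier P"
    and "\<And>x y. x \<in> A \<Longrightarrow> y \<in> carrier P \<Longrightarrow> y \<sqsubseteq>\<^bsub>P\<^esub> x \<Longrightarrow> y \<in> A"
    and "\<And>D s. directed P D \<Longrightarrow> D \<subseteq> A \<Longrightarrow> is_lub P s D \<Longrightarrow> s \<in> A"
  shows "scott_closed P A"
  using assms unfolding scott_closed_def by blast

lemma scott_closed_subset: "scott_closed P A \<Longrightarrow> A \<subseteq> carrier P"
  by (simp add: scott_closed_def)

lemma scott_closed_lower:
  "scott_closed P A \<Longrightarrow> x \<in> A \<Longrightarrow> y \<in> carrier P \<Longrightarrow> y \<sqsubseteq>\<^bsub>P\<^esub> x \<Longrightarrow> y \<in> A"
  unfolding scott_closed_def by blast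

lemma scott_closed_lattice_simps [simp]:
  "carrier (scott_closed_lattice P) = {A. scott_closed P A}"
  "le (scott_closed_lattice P) = (\<subseteq>)"
  by (auto simp: scott_closed_lattice_def)

context dcpo
begin

lemma down_subset_iff:
  assumes "x \<in> carrier P" "y \<in> carrier P"
  shows "down P x \<subseteq> down P y \<longleftrightarrow> x \<sqsubseteq> y"
  using assms unfolding down_def by (blast intro: le_trans)

lemma down_subset_closed_iff:
  assumes "scott_closed P A" "x \<in> carrier P"
  shows "down P x \<subseteq> A \<longleftrightarrow> x \<in> A"
  using assms scott_closed_lower[OF assms(1)] unfolding down_def by blast

lemma scott_closed_down:
  assumes x: "x \<in> carrier P"
  shows "scott_closed P (down P x)"
proof (rule scott_closedI)
  fix D s assume D: "directed P D" "D \<subseteq> down P x" "is_lub P s D"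
  then show "s \<in> down P x"
    using x is_lub_iff[OF directed_carrier[OF D(1)]] by (auto simp: down_def)
qed (use x in \<open>auto simp: down_def intro: le_trans\<close>)

text \<open>
  An upper bound of \<open>D\<close> in \<open>P\<close> may lie outside \<open>down P x\<close>, so that suprema agree in the two posets
  depends on the supremum existing in \<open>P\<close>.
\<close>

lemma is_lub_principal_ideal_iff:
  assumes x: "x \<in> carrier P" and D: "directed P D" "D \<subseteq> down P x"
  shows "is_lub (principal_ideal P x) s D \<longleftrightarrow> is_lub P s D"
proof -
  obtain t where t: "is_lub P t D" using directed_lub_exists D(1) by blast
  note P_lub = is_lub_iff[OF directed_carrier[OF D(1)]]
  have t': "t \<in> carrier P" "\<And>d. d \<in> D \<Longrightarrow> d \<sqsubseteq> t"
    "\<And>y. y \<in> carrier P \<Longrightarrow> (\<forall>d\<in>D. d \<sqsubseteq> y) \<Longrightarrow> t \<sqsubseteq> y"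
    using t unfolding P_lub by auto
  have "\<forall>d\<in>D. d \<sqsubseteq> x" using D(2) by (auto simp: down_def)
  then have tx: "t \<sqsubseteq> x" by (rule t'(3)[OF x])
  have R_lub: "is_lub (principal_ideal P x) s D \<longleftrightarrow> s \<in> down P x \<and> (\<forall>d\<in>D. d \<sqsubseteq> s) \<and>
    (\<forall>y\<in>down P x. (\<forall>d\<in>D. d \<sqsubseteq> y) \<longrightarrow> s \<sqsubseteq> y)"
    by (subst is_lub_iff) (use D(2) in auto)
  show ?thesis
  proof
    assume "is_lub (principal_ideal P x) s D"
    then have s: "s \<in> carrier P" "\<forall>d\<in>D. d \<sqsubseteq> s" "s \<sqsubseteq> t"
      using t' tx unfolding R_lub by (auto simp: down_def)
    then have "s = t" using t'(1,3) by (blast )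
    then show "is_lub P s D" using t by simp
  next
    assume "is_lub P s D"
    then show "is_lub (principal_ideal P x) s D"
      using x D(2) unfolding R_lub P_lub by (auto simp: down_def)
  qed
qed

lemma scott_closed_principal_ideal_imp:
  assumes x: "x \<in> carrier P" and A: "scott_closed (principal_ideal P x) A"
  shows "scott_closed P A"
proof (rule scott_closedI)
  have sub: "A \<subseteq> down P x" using scott_closed_subset[OF A] by simp
  then show "A \<subseteq> carrier P" by (auto simp: down_def)
  show "z \<in> A" if "y \<in> A" "z \<in> carrier P" "z \<sqsubseteq> y" for y z
  proof -
    have "z \<in> down P x" using that sub x by (auto simp: down_def intro: le_trans)
    then show ?thesis using scott_closed_lower[OF A that(1)] that by simp
  qed
  show "s \<in> A" if D: "directed P D" "D \<subseteq> A" "is_lub P s D" for D s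
    using scott_closed_lub[OF A _ D(2)] is_lub_principal_ideal_iff[OF x D(1)] D sub
    by (auto simp: directed_principal_ideal_iff)
qed

end


section \<open>Rudin's lemma\<close>

definition filtered_family :: "('a, 'm) gorder_scheme \<Rightarrow> 'a set set \<Rightarrow> bool" where
  "filtered_family P \<F> \<longleftrightarrow> \<F> \<noteq> {} \<and> (\<forall>F\<in>\<F>. finite F \<and> F \<subseteq> carrier P) \<and>
     (\<forall>F1\<in>\<F>. \<forall>F2\<in>\<F>. \<exists>F\<in>\<F>. F \<subseteq> up_set P F1 \<inter> up_set P F2)"

lemma filtered_familyE:
  assumes "filtered_family P \<F>" "F1 \<in> \<F>" "F2 \<in> \<F>"
  obtains F where "F \<in> \<F>" "F \<subseteq> up_set P F1" "F \<subseteq> up_set P F2"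
proof -
  have "\<forall>F1\<in>\<F>. \<forall>F2\<in>\<F>. \<exists>F\<in>\<F>. F \<subseteq> up_set P F1 \<inter> up_set P F2"
    using assms(1) by (simp add: filtered_family_def)
  from bspec[OF bspec[OF this assms(2)] assms(3)] show ?thesis using that by blast
qed

lemma up_set_trans:
  fixes P (structure)
  assumes "partial_order P" "G \<subseteq> carrier P" "F \<subseteq> up_set P G"
  shows "up_set P F \<subseteq> up_set P G"
proof -
  interpret partial_order P by fact
  show ?thesis
  proof
    fix x assume "x \<in> up_set P F"
    then obtain f where f: "f \<in> F" "x \<in> carrier P" "f \<sqsubseteq> x" by (auto simp: up_set_def)
    then obtain g where g: "g \<in> G" "g \<sqsubseteq> f" "f \<in> carrier P" using assms(3) by (auto simp: up_set_def)
    have "g \<sqsubseteq> x" using le_trans[OF g(2) f(3)] g f(2) assms(2) by blast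
    then show "x \<in> up_set P G" using g(1) f(2) by (auto simp: up_set_def)
  qed
qed

text \<open>
  Take a lower subset \<open>A\<close> of \<open>B\<close> that is minimal among those meeting every member of the family; it
  exists because the members are finite. For \<open>x\<close> in \<open>A\<close> the lower set \<open>A - {z. x \<sqsubseteq> z}\<close> must then
  miss some member, i.e. all points of \<open>A\<close> in that member lie above \<open>x\<close>. Combining two such members
  by filteredness shows that \<open>A \<inter> \<Union>\<F>\<close> is directed. The proof works with the complement \<open>U\<close> of \<open>A\<close>
  in \<open>B\<close>, so that Zorn's lemma applies to unions of chains.
\<close>

lemma (in partial_order) Rudin:
  assumes \<F>: "filtered_family L \<F>"
    and B: "B \<subseteq> carrier L" "\<forall>x\<in>B. \<forall>y\<in>carrier L. y \<sqsubseteq> x \<longrightarrow> y \<in> B"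
    and meets: "\<forall>F\<in>\<F>. F \<inter> B \<noteq> {}"
  obtains D where "directed L D" "D \<subseteq> B \<inter> \<Union>\<F>" "\<And>F. F \<in> \<F> \<Longrightarrow> D \<inter> F \<noteq> {}"
proof -
  define \<U> where "\<U> = {U. U \<subseteq> B \<and> (\<forall>x\<in>U. \<forall>y\<in>B. x \<sqsubseteq> y \<longrightarrow> y \<in> U) \<and> (\<forall>F\<in>\<F>. \<not> F \<inter> B \<subseteq> U)}"
  have fin: "finite F" "F \<subseteq> carrier L" if "F \<in> \<F>" for F
    using \<F> that by (auto simp: filtered_family_def)
  have "\<exists>U\<in>\<U>. \<forall>V\<in>\<U>. U \<subseteq> V \<longrightarrow> V = U"
  proof (rule subset_Zorn_nonempty)
    have "{} \<in> \<U>" using meets by (auto simp: \<U>_def)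
    then show "\<U> \<noteq> {}" by blast
  next
    fix \<C> assume C: "\<C> \<noteq> {}" "subset.chain \<U> \<C>"
    then have sub: "\<C> \<subseteq> \<U>" by (simp add: subset_chain_def)
    have "\<not> F \<inter> B \<subseteq> \<Union>\<C>" if F: "F \<in> \<F>" for F
    proof
      assume "F \<inter> B \<subseteq> \<Union>\<C>"
      then obtain U where "U \<in> \<C>" "F \<inter> B \<subseteq> U"
        using finite_subset_Union_chain[OF finite_Int[OF disjI1[OF fin(1)[OF F]]] _ C] by metis
      then show False using sub F by (auto simp: \<U>_def)
    qed
    then show "\<Union>\<C> \<in> \<U>" using sub unfolding \<U>_def by blast
  qed
  then obtain U where U: "U \<in> \<U>" and maximal: "\<And>V. V \<in> \<U> \<Longrightarrow> U \<subseteq> V \<Longrightarrow> V = U" by blast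
  have U_sub: "U \<subseteq> B" and U_up: "\<And>x y. x \<in> U \<Longrightarrow> y \<in> B \<Longrightarrow> x \<sqsubseteq> y \<Longrightarrow> y \<in> U"
    and U_misses: "\<And>F. F \<in> \<F> \<Longrightarrow> \<not> F \<inter> B \<subseteq> U"
    using U by (auto simp: \<U>_def)
  define D where "D = (B - U) \<inter> \<Union>\<F>"
  have member_above: "\<exists>F\<in>\<F>. \<forall>z\<in>F \<inter> (B - U). x \<sqsubseteq> z" if x: "x \<in> B - U" for x
  proof (rule ccontr)
    assume neg: "\<not> ?thesis"
    let ?V = "U \<union> {z \<in> B. x \<sqsubseteq> z}"
    have "?V \<in> \<U>"
      unfolding \<U>_def
    proof (intro CollectI conjI ballI impI)
      show "?V \<subseteq> B" using U_sub by auto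
      show "z \<in> ?V" if "y \<in> ?V" "z \<in> B" "y \<sqsubseteq> z" for y z
        using that U_sub U_up B(1) x le_trans[of x y z] by blast
      show "\<not> F \<inter> B \<subseteq> ?V" if "F \<in> \<F>" for F using neg that by blast
    qed
    then have "?V = U" using maximal by blast
    moreover have "x \<in> ?V" using x B(1) by auto
    ultimately show False using x by blast
  qed
  have meets_D: "D \<inter> F \<noteq> {}" if F: "F \<in> \<F>" for F
    using U_misses[OF F] F by (auto simp: D_def)
  have "\<exists>z\<in>D. x \<sqsubseteq> z \<and> y \<sqsubseteq> z" if xy: "x \<in> D" "y \<in> D" for x y
  proof -
    have xy': "x \<in> B - U" "y \<in> B - U" using xy by (auto simp: D_def)
    obtain F1 where F1: "F1 \<in> \<F>" "\<And>z. z \<in> F1 \<Longrightarrow> z \<in> B - U \<Longrightarrow> x \<sqsubseteq> z"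
      using member_above[OF xy'(1)] by blast
    obtain F2 where F2: "F2 \<in> \<F>" "\<And>z. z \<in> F2 \<Longrightarrow> z \<in> B - U \<Longrightarrow> y \<sqsubseteq> z"
      using member_above[OF xy'(2)] by blast
    obtain F where F: "F \<in> \<F>" "F \<subseteq> up_set L F1" "F \<subseteq> up_set L F2"
      using filtered_familyE[OF \<F> F1(1) F2(1)] .
    obtain z where z: "z \<in> D" "z \<in> F" using meets_D[OF F(1)] by blast
    obtain a b where ab: "a \<in> F1" "a \<sqsubseteq> z" "b \<in> F2" "b \<sqsubseteq> z"
      using z(2) F(2,3) unfolding up_set_def by blast
    have ab_carrier: "a \<in> carrier L" "b \<in> carrier L" using ab F1(1) F2(1) fin(2) by blast+
    have zB: "z \<in> B" "z \<notin> U" using z(1) by (auto simp: D_def)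
    have "a \<in> B - U" "b \<in> B - U"
      using zB(2) ab(2,4) bspec[OF B(2) zB(1)] ab_carrier U_up[OF _ zB(1)] by blast+
    then have "x \<sqsubseteq> a" "y \<sqsubseteq> b" using F1(2) F2(2) ab by auto
    moreover have "x \<in> carrier L" "y \<in> carrier L" "z \<in> carrier L"
      using xy zB(1) B(1) by (auto simp: D_def)
    ultimately show ?thesis using z(1) ab(2,4) ab_carrier le_trans by blast
  qed
  moreover have "D \<noteq> {}" using meets_D \<F> by (auto simp: filtered_family_def)
  ultimately have "directed L D" using B(1) by (auto simp: directed_def D_def)
  then show ?thesis using that meets_D by (auto simp: D_def)
qed

text \<open>
  The directed set that \<open>Rudin\<close> selects lies in \<open>A\<close>, hence so does its supremum, which is above a
  point of each member of the family.
\<close>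

lemma (in dcpo) Rudin_scott_closed:
  assumes \<F>: "filtered_family P \<F>" and A: "scott_closed P A" and meets: "\<forall>F\<in>\<F>. F \<inter> A \<noteq> {}"
  obtains t where "t \<in> A" "\<And>F. F \<in> \<F> \<Longrightarrow> t \<in> up_set P F"
proof -
  have "\<forall>x\<in>A. \<forall>y\<in>carrier P. y \<sqsubseteq> x \<longrightarrow> y \<in> A" using A by (simp add: scott_closed_def)
  then obtain E where E: "directed P E" "E \<subseteq> A \<inter> \<Union>\<F>" "\<And>F. F \<in> \<F> \<Longrightarrow> E \<inter> F \<noteq> {}"
    using Rudin[OF \<F> scott_closed_subset[OF A] _ meets] by metis
  obtain t where t: "is_lub P t E" using directed_lub_exists[OF E(1)] by blast
  have "t \<in> A" using scott_closed_lub[OF A E(1) _ t] E(2) by blast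
  moreover have "t \<in> up_set P F" if "F \<in> \<F>" for F
    using E(3)[OF that] t is_lub_iff[OF directed_carrier[OF E(1)], of t] by (auto simp: up_set_def)
  ultimately show ?thesis using that by blast
qed


section \<open>Order isomorphisms and C-compact elements\<close>

text \<open>
  In a complete lattice these are the C-compact elements of Ho and Zhao other than the least element:
  the family \<open>X\<close> may be empty, and its supremum is then the least element. The notion refers only to
  the order, so it is invariant under isomorphisms.
\<close>

definition C_compact :: "('a, 'm) gorder_scheme \<Rightarrow> 'a \<Rightarrow> bool" where
  "C_compact L a \<longleftrightarrow> a \<in> carrier L \<and>
     (\<forall>X u. scott_closed L X \<and> is_lub L u X \<and> a \<sqsubseteq>\<^bsub>L\<^esub> u \<longrightarrow> a \<in> X)"

lemma C_compactD:
  assumes "C_compact L a" "scott_closed L X" "is_lub L u X" "a \<sqsubseteq>\<^bsub>L\<^esub> u"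
  shows "a \<in> X"
  using assms unfolding C_compact_def by blast

locale order_iso =
  fixes L :: "('a, 'm) gorder_scheme" and M :: "('b, 'n) gorder_scheme" and h
  assumes bij: "bij_betw h (carrier L) (carrier M)"
    and le_iff: "\<And>x y. x \<in> carrier L \<Longrightarrow> y \<in> carrier L \<Longrightarrow> h x \<sqsubseteq>\<^bsub>M\<^esub> h y \<longleftrightarrow> x \<sqsubseteq>\<^bsub>L\<^esub> y"
begin

lemma image_carrier: "h ` carrier L = carrier M"
  using bij by (simp add: bij_betw_def)

lemma is_lub_image_iff:
  assumes "A \<subseteq> carrier L" "s \<in> carrier L"
  shows "is_lub M (h s) (h ` A) \<longleftrightarrow> is_lub L s A"
proof -
  have "h ` A \<subseteq> carrier M" using assms(1) image_carrier by blast
  then have "is_lub M (h s) (h ` A) \<longleftrightarrow> h s \<in> h ` carrier L \<and> (\<forall>a\<in>A. h a \<sqsubseteq>\<^bsub>M\<^esub> h s) \<and>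
    (\<forall>y\<in>carrier L. (\<forall>a\<in>A. h a \<sqsubseteq>\<^bsub>M\<^esub> h y) \<longrightarrow> h s \<sqsubseteq>\<^bsub>M\<^esub> h y)"
    using is_lub_iff[of "h ` A" M "h s"] by (simp flip: image_carrier)
  also have "\<dots> \<longleftrightarrow> is_lub L s A"
    using assms by (simp add: is_lub_iff le_iff subset_iff)
  finally show ?thesis .
qed

lemma directed_image:
  assumes "directed L D"
  shows "directed M (h ` D)"
  unfolding directed_def
proof (intro conjI ballI)
  have sub: "D \<subseteq> carrier L" using assms by (rule directed_carrier)
  then show "h ` D \<subseteq> carrier M" using image_carrier by blast
  show "h ` D \<noteq> {}" using assms by (auto simp: directed_def)
  fix a b assume "a \<in> h ` D" "b \<in> h ` D"
  then obtain d e where de: "d \<in> D" "a = h d" "e \<in> D" "b = h e" by blast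
  obtain z where z: "z \<in> D" "d \<sqsubseteq>\<^bsub>L\<^esub> z" "e \<sqsubseteq>\<^bsub>L\<^esub> z"
    using directedE[OF assms de(1,3)] .
  then have "a \<sqsubseteq>\<^bsub>M\<^esub> h z" "b \<sqsubseteq>\<^bsub>M\<^esub> h z" using de sub by (auto simp: le_iff subsetD)
  then show "\<exists>c\<in>h ` D. a \<sqsubseteq>\<^bsub>M\<^esub> c \<and> b \<sqsubseteq>\<^bsub>M\<^esub> c" using z(1) by blast
qed

lemma scott_closed_preimage:
  assumes X: "scott_closed M X"
  shows "scott_closed L {a \<in> carrier L. h a \<in> X}"
proof (rule scott_closedI)
  fix a b assume "a \<in> {a \<in> carrier L. h a \<in> X}" "b \<in> carrier L" "b \<sqsubseteq>\<^bsub>L\<^esub> a"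
  then show "b \<in> {a \<in> carrier L. h a \<in> X}"
    using scott_closed_lower[OF X, of "h a" "h b"] image_carrier le_iff by auto
next
  fix D s assume D: "directed L D" "D \<subseteq> {a \<in> carrier L. h a \<in> X}" "is_lub L s D"
  have s: "s \<in> carrier L" using D(3) by blast
  then have "is_lub M (h s) (h ` D)"
    using is_lub_image_iff directed_carrier[OF D(1)] D(3) by blast
  then have "h s \<in> X"
    using scott_closed_lub[OF X directed_image[OF D(1)]] D(2) by blast
  then show "s \<in> {a \<in> carrier L. h a \<in> X}" using s by simp
qed simp

lemma C_compact_image:
  assumes a: "C_compact L a"
  shows "C_compact M (h a)"
  unfolding C_compact_def
proof (intro conjI allI impI)
  have aL: "a \<in> carrier L" using a by (simp add: C_compact_def)
  then show "h a \<in> carrier M" using image_carrier by blast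
  fix X v assume X: "scott_closed M X \<and> is_lub M v X \<and> h a \<sqsubseteq>\<^bsub>M\<^esub> v"
  let ?Y = "{b \<in> carrier L. h b \<in> X}"
  have img: "h ` ?Y = X" using X scott_closed_subset image_carrier by fast
  have "v \<in> carrier M" using X by blast
  then obtain u where u: "u \<in> carrier L" "v = h u" using image_carrier by blast
  have "is_lub L u ?Y" using is_lub_image_iff[of ?Y u] u img X by auto
  moreover have "scott_closed L ?Y" using scott_closed_preimage X by blast
  ultimately have "a \<in> ?Y" if "a \<sqsubseteq>\<^bsub>L\<^esub> u"
    using C_compactD[OF a _ _ that] by blast
  moreover have "a \<sqsubseteq>\<^bsub>L\<^esub> u" using le_iff aL u X by blast
  ultimately show "h a \<in> X" by simp
qed

end

lemma (in dcpo) is_lub_down: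
  assumes D: "directed P D" and s: "is_lub P s D"
  shows "directed (scott_closed_lattice P) (down P ` D)"
    and "is_lub (scott_closed_lattice P) (down P s) (down P ` D)"
proof -
  have sub: "D \<subseteq> carrier P" using D by (rule directed_carrier)
  have s': "s \<in> carrier P" "\<And>d. d \<in> D \<Longrightarrow> d \<sqsubseteq> s" using s is_lub_iff[OF sub] by auto
  have sub_C: "down P ` D \<subseteq> carrier (scott_closed_lattice P)"
    using sub by (auto simp: scott_closed_down)
  show "directed (scott_closed_lattice P) (down P ` D)"
    unfolding directed_def
  proof (intro conjI ballI sub_C)
    show "down P ` D \<noteq> {}" using D by (auto simp: directed_def)
    fix A B assume "A \<in> down P ` D" "B \<in> down P ` D"
    then obtain d e where de: "d \<in> D" "A = down P d" "e \<in> D" "B = down P e" by blast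
    obtain z where z: "z \<in> D" "d \<sqsubseteq> z" "e \<sqsubseteq> z" using directedE[OF D de(1,3)] .
    have "A \<subseteq> down P z" "B \<subseteq> down P z"
      using z de sub by (auto simp: down_subset_iff subsetD)
    then show "\<exists>C\<in>down P ` D. A \<sqsubseteq>\<^bsub>scott_closed_lattice P\<^esub> C \<and> B \<sqsubseteq>\<^bsub>scott_closed_lattice P\<^esub> C"
      using z(1) by auto
  qed
  have "down P s \<subseteq> C" if C: "scott_closed P C" "\<forall>d\<in>D. down P d \<subseteq> C" for C
  proof -
    have "D \<subseteq> C" using C(2) sub by (auto simp: down_subset_closed_iff[OF C(1)] subsetD)
    then have "s \<in> C" by (rule scott_closed_lub[OF C(1) D _ s])
    then show ?thesis by (simp add: down_subset_closed_iff[OF C(1) s'(1)])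
  qed
  then show "is_lub (scott_closed_lattice P) (down P s) (down P ` D)"
    using s' sub by (subst is_lub_iff[OF sub_C]) (auto simp: scott_closed_down down_subset_iff subsetD)
qed

text \<open>
  The supremum of a Scott closed family of closed sets is its plain union: a directed set in
  the union yields a directed family of principal ideals in the family, by \<open>is_lub_down\<close>.
\<close>

lemma (in dcpo) C_compact_down:
  assumes x: "x \<in> carrier P"
  shows "C_compact (scott_closed_lattice P) (down P x)"
  unfolding C_compact_def
proof (intro conjI allI impI)
  show "down P x \<in> carrier (scott_closed_lattice P)" using x by (simp add: scott_closed_down)
  fix \<X> U assume *: "scott_closed (scott_closed_lattice P) \<X> \<and>
    is_lub (scott_closed_lattice P) U \<X> \<and> down P x \<sqsubseteq>\<^bsub>scott_closed_lattice P\<^esub> U"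
  then have \<X>: "scott_closed (scott_closed_lattice P) \<X>" by blast
  have closed: "scott_closed P A" if "A \<in> \<X>" for A
    using scott_closed_subset[OF \<X>] that by auto
  have down_mem: "down P y \<in> \<X> \<longleftrightarrow> y \<in> \<Union>\<X>" if y: "y \<in> carrier P" for y
  proof
    have "y \<in> down P y" using y by (simp add: down_def)
    then show "y \<in> \<Union>\<X>" if "down P y \<in> \<X>" using that by blast
    assume "y \<in> \<Union>\<X>"
    then obtain A where A: "A \<in> \<X>" "y \<in> A" by blast
    then have "down P y \<subseteq> A" using down_subset_closed_iff[OF closed[OF A(1)] y] by simp
    then show "down P y \<in> \<X>"
      using scott_closed_lower[OF \<X> A(1)] y by (simp add: scott_closed_down)
  qed
  have "scott_closed P (\<Union>\<X>)"
  proof (rule scott_closedI)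
    show "\<Union>\<X> \<subseteq> carrier P" using closed scott_closed_subset by blast
    show "z \<in> \<Union>\<X>" if "y \<in> \<Union>\<X>" "z \<in> carrier P" "z \<sqsubseteq> y" for y z
      using that closed scott_closed_lower[of P _ y z] by blast
    fix D s assume D: "directed P D" "D \<subseteq> \<Union>\<X>" "is_lub P s D"
    have "down P ` D \<subseteq> \<X>" using D(2) directed_carrier[OF D(1)] down_mem by blast
    then have "down P s \<in> \<X>" using scott_closed_lub[OF \<X>] is_lub_down[OF D(1,3)] by blast
    then show "s \<in> \<Union>\<X>" using down_mem D(3) by blast
  qed
  then have "U \<subseteq> \<Union>\<X>"
    using * is_lub_iff[OF scott_closed_subset[OF \<X>]] by auto
  then have "x \<in> \<Union>\<X>" using * x by (auto simp: down_def)
  then show "down P x \<in> \<X>" using down_mem x by blast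
qed


section \<open>C-compact closed sets under property M\<close>

text \<open>
  For directed \<open>D\<close>, the sets of minimal upper bounds of \<open>{d, c}\<close> form a filtered family of finite
  sets as \<open>d\<close> runs through \<open>D\<close>, and each of them meets \<open>A\<close>. By \<open>Rudin_scott_closed\<close> a single point
  of \<open>A\<close> lies above a member of each of them, hence above all of \<open>D\<close> and \<open>c\<close>.
\<close>

lemma (in dcpo) scott_closed_compatible:
  assumes M: "property_M P" and A: "scott_closed P A" and c: "c \<in> carrier P"
  shows "scott_closed P {b \<in> carrier P. \<exists>u\<in>A. b \<sqsubseteq> u \<and> c \<sqsubseteq> u}" (is "scott_closed P ?K")
proof (rule scott_closedI)
  note sub_A = scott_closed_subset[OF A]
  show "?K \<subseteq> carrier P" by blast
  show "y \<in> ?K" if "x \<in> ?K" "y \<in> carrier P" "y \<sqsubseteq> x" for x y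
    using that sub_A by (blast intro: le_trans)
  fix D s assume D: "directed P D" "D \<subseteq> ?K" "is_lub P s D"
  define \<F> where "\<F> = (\<lambda>d. mub P {d, c}) ` D"
  have sub: "D \<subseteq> carrier P" using D(1) by (rule directed_carrier)
  have mub_mem: "u \<in> carrier P" "d \<sqsubseteq> u" "c \<sqsubseteq> u" if "u \<in> mub P {d, c}" "d \<in> D" for u d
    using that sub c by (auto simp: mub_def Upper_def)
  have mub_below: "\<exists>m\<in>mub P {d, c}. m \<sqsubseteq> u" if "d \<in> D" "u \<in> carrier P" "d \<sqsubseteq> u" "c \<sqsubseteq> u" for d u
  proof -
    have "{d, c} \<subseteq> carrier P" using that(1) sub c by blast
    then have "mub_complete P {d, c}"
      using M by (simp add: property_M_def property_m_def)
    moreover have "u \<in> Upper P {d, c}" using that by (auto simp: Upper_def)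
    ultimately show ?thesis unfolding mub_complete_def by blast
  qed
  have "\<exists>F\<in>\<F>. F \<subseteq> up_set P (mub P {d1, c}) \<inter> up_set P (mub P {d2, c})"
    if d: "d1 \<in> D" "d2 \<in> D" for d1 d2
  proof -
    obtain d where d': "d \<in> D" "d1 \<sqsubseteq> d" "d2 \<sqsubseteq> d" using directedE[OF D(1) d] .
    have "mub P {d, c} \<subseteq> up_set P (mub P {e, c})" if e: "e \<in> D" "e \<sqsubseteq> d" for e
    proof
      fix u assume u: "u \<in> mub P {d, c}"
      then have "e \<sqsubseteq> u" using mub_mem[OF u d'(1)] e sub d'(1) le_trans[of e d u] by blast
      then show "u \<in> up_set P (mub P {e, c})"
        using mub_below[OF e(1)] mub_mem[OF u d'(1)] by (auto simp: up_set_def)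
    qed
    then show ?thesis using d d' by (auto simp: \<F>_def)
  qed
  moreover have "finite (mub P {d, c})" if "d \<in> D" for d
  proof -
    have "{d, c} \<subseteq> carrier P" using that sub c by blast
    then show ?thesis using M by (simp add: property_M_def)
  qed
  ultimately have filtered: "filtered_family P \<F>"
    using D(1) mub_mem(1) unfolding filtered_family_def by (auto simp: \<F>_def directed_def)
  have "F \<inter> A \<noteq> {}" if F: "F \<in> \<F>" for F
  proof -
    obtain d where d: "d \<in> D" "F = mub P {d, c}" using F by (auto simp: \<F>_def)
    then obtain u where u: "u \<in> A" "d \<sqsubseteq> u" "c \<sqsubseteq> u" using D(2) by blast
    then obtain m where m: "m \<in> F" "m \<sqsubseteq> u" using mub_below[OF d(1), of u] sub_A d(2) by blast
    then have "m \<in> A" using scott_closed_lower[OF A u(1)] mub_mem(1) d by blast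
    then show ?thesis using m(1) by blast
  qed
  then obtain t where t: "t \<in> A" "\<And>F. F \<in> \<F> \<Longrightarrow> t \<in> up_set P F"
    using Rudin_scott_closed[OF filtered A] by blast
  have tP: "t \<in> carrier P" using t(1) sub_A by blast
  have above: "d \<sqsubseteq> t \<and> c \<sqsubseteq> t" if d: "d \<in> D" for d
  proof -
    obtain e where e: "e \<in> mub P {d, c}" "e \<sqsubseteq> t"
      using t(2)[of "mub P {d, c}"] d by (auto simp: \<F>_def up_set_def)
    have dP: "d \<in> carrier P" using d sub by blast
    note mub_mem[OF e(1) d]
    then show ?thesis using dP c tP e(2) le_trans[of d e t] le_trans[of c e t] by blast
  qed
  have "s \<in> carrier P" "s \<sqsubseteq> t" using D(3) above tP is_lub_iff[OF sub] by auto
  moreover have "c \<sqsubseteq> t" using above D(1) by (auto simp: directed_def)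
  moreover note t(1)
  ultimately show "s \<in> ?K" by blast
qed

lemma (in dcpo) C_compact_imp_principal:
  assumes M: "property_M P" and A: "C_compact (scott_closed_lattice P) A"
  shows "\<exists>p\<in>carrier P. A = down P p"
proof -
  let ?C = "scott_closed_lattice P"
  have A_closed: "scott_closed P A" using A by (simp add: C_compact_def)
  note sub_A = scott_closed_subset[OF A_closed]
  define K where "K c = {b \<in> carrier P. \<exists>u\<in>A. b \<sqsubseteq> u \<and> c \<sqsubseteq> u}" for c
  have K_closed: "scott_closed P (K c)" if "c \<in> carrier P" for c
    unfolding K_def by (rule scott_closed_compatible[OF M A_closed that])
  define \<E> where "\<E> = {B. scott_closed P B \<and> B \<subseteq> A \<and> (\<forall>c\<in>B. B \<subseteq> K c)}"
  have \<E>_closed: "scott_closed ?C \<E>"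
  proof (rule scott_closedI)
    show "\<E> \<subseteq> carrier ?C" by (auto simp: \<E>_def)
    show "B' \<in> \<E>" if "B \<in> \<E>" "B' \<in> carrier ?C" "B' \<sqsubseteq>\<^bsub>?C\<^esub> B" for B B'
      using that unfolding \<E>_def by auto
    fix \<B> S assume \<B>: "directed ?C \<B>" "\<B> \<subseteq> \<E>" "is_lub ?C S \<B>"
    have S: "scott_closed P S" "\<And>B. B \<in> \<B> \<Longrightarrow> B \<subseteq> S"
      "\<And>T. scott_closed P T \<Longrightarrow> \<Union>\<B> \<subseteq> T \<Longrightarrow> S \<subseteq> T"
      using \<B>(3) is_lub_iff[OF directed_carrier[OF \<B>(1)], of S] by (simp_all add: Sup_le_iff)
    have \<B>_mem: "B \<subseteq> A" "\<forall>c\<in>B. B \<subseteq> K c" if "B \<in> \<B>" for B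
      using subsetD[OF \<B>(2) that] by (simp_all add: \<E>_def)
    have "S \<subseteq> A" by (rule S(3)[OF A_closed Sup_least]) (rule \<B>_mem(1))
    have Un_K: "\<Union>\<B> \<subseteq> K c" if "c \<in> \<Union>\<B>" for c
    proof
      fix b assume "b \<in> \<Union>\<B>"
      then obtain B1 B2 where B12: "B1 \<in> \<B>" "b \<in> B1" "B2 \<in> \<B>" "c \<in> B2"
        using \<open>c \<in> \<Union>\<B>\<close> by blast
      obtain B where B: "B \<in> \<B>" "B1 \<subseteq> B" "B2 \<subseteq> B"
        using directedE[OF \<B>(1) B12(1,3)] by auto
      have "c \<in> B" "b \<in> B" using B B12 by blast+
      then show "b \<in> K c" using \<B>_mem(2)[OF B(1)] by blast
    qed
    have Un_sub: "\<Union>\<B> \<subseteq> carrier P" using \<B>_mem(1) sub_A by blast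
    \<comment> \<open>Compatibility is symmetric, so the extension from the union to \<open>S\<close> can be done in one
      argument at a time.\<close>
    have "S \<subseteq> K c" if c: "c \<in> \<Union>\<B>" for c
      by (rule S(3)[OF K_closed Un_K[OF c]]) (use c Un_sub in blast)
    then have "\<Union>\<B> \<subseteq> K b" if "b \<in> S" for b
      using that Un_sub unfolding K_def by blast
    then have "S \<subseteq> K b" if "b \<in> S" for b
      using S(3)[OF K_closed, of b] that \<open>S \<subseteq> A\<close> sub_A by blast
    then show "S \<in> \<E>" using S(1) \<open>S \<subseteq> A\<close> by (simp add: \<E>_def)
  qed
  have down_mem: "down P a \<in> \<E>" if a: "a \<in> A" for a
  proof -
    have "a \<in> carrier P" using a sub_A by blast
    then show ?thesis
      using a down_subset_closed_iff[OF A_closed] scott_closed_down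
      by (auto simp: \<E>_def K_def down_def)
  qed
  have "A \<subseteq> T" if "scott_closed P T" "\<And>B. B \<in> \<E> \<Longrightarrow> B \<subseteq> T" for T
    using that down_mem sub_A down_subset_closed_iff[OF that(1)] by blast
  then have "is_lub ?C A \<E>"
    using A_closed by (subst is_lub_iff) (auto simp: \<E>_def)
  then have "A \<in> \<E>" using C_compactD[OF A \<E>_closed] by simp
  then have "\<forall>c\<in>A. A \<subseteq> K c" by (simp add: \<E>_def)
  moreover have "A \<noteq> {}"
  proof
    assume "A = {}"
    moreover have "scott_closed P {}" "scott_closed ?C {}"
      by (auto intro!: scott_closedI simp: directed_def)
    moreover from this(1) have "is_lub ?C {} {}" by (subst is_lub_iff) auto
    ultimately show False using C_compactD[OF A, of "{}" "{}"] by simp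
  qed
  ultimately have directed: "directed P A" using sub_A by (auto simp: directed_def K_def)
  then obtain p where p: "is_lub P p A" using directed_lub_exists by blast
  have "p \<in> A" using scott_closed_lub[OF A_closed directed _ p] by blast
  then have "p \<in> carrier P" "down P p \<subseteq> A"
    using sub_A down_subset_closed_iff[OF A_closed] by blast+
  moreover have "A \<subseteq> down P p" using p sub_A by (auto simp: is_lub_iff[OF sub_A] down_def)
  ultimately show ?thesis by blast
qed


section \<open>Quasicontinuous dcpos\<close>

lemma way_below_mono:
  assumes "partial_order P" "F \<subseteq> carrier P" "G \<subseteq> up_set P F" "way_below P G x"
  shows "way_below P F x"
  using up_set_trans[OF assms(1-3)] assms(4) unfolding way_below_def by blast

lemma (in partial_order) way_below_le:
  assumes "way_below L F x" "x \<sqsubseteq> y" "x \<in> carrier L" "y \<in> carrier L"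
  shows "way_below L F y"
  unfolding way_below_def
proof (intro allI impI)
  fix D s assume D: "directed L D \<and> is_lub L s D \<and> y \<sqsubseteq> s"
  then have "s \<in> carrier L" by blast
  then have "x \<sqsubseteq> s" using D assms le_trans[of x y s] by blast
  then show "D \<inter> up_set L F \<noteq> {}" using assms(1) D unfolding way_below_def by blast
qed

lemma (in dcpo) way_below_imp_up_set:
  assumes "way_below P F x" "x \<in> carrier P"
  shows "x \<in> up_set P F"
proof -
  have "directed P {x}" "is_lub P x {x}"
    using assms(2) by (auto simp: directed_def is_lub_iff)
  then show ?thesis using assms unfolding way_below_def by blast
qed

text \<open>
  In the Scott topology this says that \<open>S\<close> meets every nonempty locally closed set, which amounts to
  a Scott closed set being determined by its trace on \<open>S\<close>.
\<close>

definition very_dense :: "('a, 'm) gorder_scheme \<Rightarrow> 'a set \<Rightarrow> bool" where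
  "very_dense P S \<longleftrightarrow>
     (\<forall>A B. scott_closed P A \<and> scott_closed P B \<and> \<not> A \<subseteq> B \<longrightarrow> (\<exists>s\<in>S. s \<in> A - B))"

lemma very_denseD:
  "very_dense P S \<Longrightarrow> scott_closed P A \<Longrightarrow> scott_closed P B \<Longrightarrow> \<not> A \<subseteq> B \<Longrightarrow> \<exists>s\<in>S. s \<in> A - B"
  unfolding very_dense_def by blast

locale quasicontinuous = dcpo +
  assumes quasicontinuous: "quasicontinuous_dcpo P"
begin

lemma filtered_family_fin_below:
  assumes "x \<in> carrier P"
  shows "filtered_family P (fin_below P x)"
proof -
  have "\<forall>F\<in>fin_below P x. finite F \<and> F \<subseteq> carrier P" by (simp add: fin_below_def)
  then show ?thesis
    using quasicontinuous assms unfolding quasicontinuous_dcpo_def filtered_family_def by simp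
qed

lemma fin_below_separates:
  assumes "x \<in> carrier P" "y \<in> carrier P" "\<not> x \<sqsubseteq> y"
  obtains F where "F \<in> fin_below P x" "y \<notin> up_set P F"
proof -
  have "\<forall>y\<in>carrier P. \<not> x \<sqsubseteq> y \<longrightarrow> (\<exists>F\<in>fin_below P x. y \<notin> up_set P F)"
    using quasicontinuous assms(1) by (simp add: quasicontinuous_dcpo_def)
  then show ?thesis using assms(2,3) that by blast
qed

text \<open>
  A supremum \<open>z\<close> of a directed set \<open>D\<close> is already captured by the finite sets way below members of
  \<open>D\<close>. If none of these lies in \<open>up_set P F\<close>, Rudin's lemma applied to the complement of
  \<open>up_set P F\<close> gives a directed set there whose supremum is above \<open>z\<close>, so \<open>F\<close> is not way below \<open>z\<close>.
\<close>

lemma scott_closed_not_way_below: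
  assumes F: "F \<subseteq> carrier P"
  shows "scott_closed P {z \<in> carrier P. \<not> way_below P F z}" (is "scott_closed P ?N")
proof (rule scott_closedI)
  show "y \<in> ?N" if "x \<in> ?N" "y \<in> carrier P" "y \<sqsubseteq> x" for x y
    using that way_below_le[of F y x] by blast
next
  fix D z assume D: "directed P D" "D \<subseteq> ?N" "is_lub P z D"
  note sub = directed_carrier[OF D(1)]
  have z: "z \<in> carrier P" using D(3) by blast
  have "\<not> way_below P F z"
  proof
    assume way: "way_below P F z"
    define \<F> where "\<F> = (\<Union>d\<in>D. fin_below P d)"
    let ?B = "carrier P - up_set P F"
    have fin_below_mono: "fin_below P d \<subseteq> fin_below P e"
      if "d \<sqsubseteq> e" "d \<in> carrier P" "e \<in> carrier P" for d e
      using way_below_le[OF _ that] by (auto simp: fin_below_def)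
    have filtered: "filtered_family P \<F>"
      unfolding filtered_family_def
    proof (intro conjI ballI)
      have "D \<noteq> {}" using D(1) by (simp add: directed_def)
      then obtain d where d: "d \<in> D" "d \<in> carrier P" using sub by blast
      have "fin_below P d \<noteq> {}"
        using filtered_family_fin_below[OF d(2)] by (simp add: filtered_family_def)
      then show "\<F> \<noteq> {}" using d(1) by (auto simp: \<F>_def)
      show "finite G" "G \<subseteq> carrier P" if "G \<in> \<F>" for G
        using that by (auto simp: \<F>_def fin_below_def)
      fix G1 G2 assume "G1 \<in> \<F>" "G2 \<in> \<F>"
      then obtain d1 d2 where d12: "d1 \<in> D" "d2 \<in> D" "G1 \<in> fin_below P d1" "G2 \<in> fin_below P d2"
        by (auto simp: \<F>_def)
      obtain d where d: "d \<in> D" "d1 \<sqsubseteq> d" "d2 \<sqsubseteq> d" using directedE[OF D(1) d12(1,2)] .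
      then have "G1 \<in> fin_below P d" "G2 \<in> fin_below P d"
        using fin_below_mono[of d1 d] fin_below_mono[of d2 d] d12 sub by blast+
      moreover have "d \<in> carrier P" using d(1) sub by blast
      ultimately obtain G where "G \<in> fin_below P d" "G \<subseteq> up_set P G1" "G \<subseteq> up_set P G2"
        using filtered_familyE[OF filtered_family_fin_below] by blast
      then show "\<exists>G\<in>\<F>. G \<subseteq> up_set P G1 \<inter> up_set P G2" using d(1) by (auto simp: \<F>_def)
    qed
    have meets: "\<forall>G\<in>\<F>. G \<inter> ?B \<noteq> {}"
    proof (intro ballI notI)
      fix G assume G: "G \<in> \<F>"
      assume *: "G \<inter> ?B = {}"
      obtain d where d: "d \<in> D" "G \<subseteq> carrier P" "way_below P G d"
        using G by (auto simp: \<F>_def fin_below_def)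
      have "G \<subseteq> up_set P F" using * d(2) by blast
      then have "way_below P F d"
        by (rule way_below_mono[OF partial_order_axioms F _ d(3)])
      then show False using d(1) D(2) by blast
    qed
    have lower: "\<forall>x\<in>?B. \<forall>y\<in>carrier P. y \<sqsubseteq> x \<longrightarrow> y \<in> ?B"
      using F unfolding up_set_def by (blast intro: le_trans)
    obtain E where E: "directed P E" "E \<subseteq> ?B \<inter> \<Union>\<F>" "\<And>G. G \<in> \<F> \<Longrightarrow> E \<inter> G \<noteq> {}"
      using Rudin[OF filtered Diff_subset lower meets] by metis
    obtain t where t: "is_lub P t E" using directed_lub_exists[OF E(1)] by blast
    have t': "t \<in> carrier P" "\<And>e. e \<in> E \<Longrightarrow> e \<sqsubseteq> t"
      using t is_lub_iff[OF directed_carrier[OF E(1)]] by auto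
    have "d \<sqsubseteq> t" if d: "d \<in> D" for d
    proof (rule ccontr)
      assume "\<not> d \<sqsubseteq> t"
      then obtain G where G: "G \<in> fin_below P d" "t \<notin> up_set P G"
        using fin_below_separates[OF subsetD[OF sub d] t'(1)] by metis
      then obtain e where "e \<in> E" "e \<in> G" using E(3) d unfolding \<F>_def by blast
      then show False using G(2) t' by (auto simp: up_set_def)
    qed
    then have "z \<sqsubseteq> t" using D(3) t'(1) by (simp add: is_lub_iff[OF sub])
    then have "E \<inter> up_set P F \<noteq> {}" using way E(1) t unfolding way_below_def by blast
    then show False using E(2) by blast
  qed
  then show "z \<in> ?N" using z by blast
qed blast

text \<open>
  If every finite set way below \<open>x\<close> met \<open>C\<close>, then \<open>Rudin_scott_closed\<close> would give a point of \<open>C\<close> in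
  all their upper sets. By quasicontinuity such a point is above \<open>x\<close>, which would put \<open>x\<close> into \<open>C\<close>.
\<close>

lemma fin_below_avoids_closed:
  assumes C: "scott_closed P C" and x: "x \<in> carrier P" "x \<notin> C"
  obtains H where "H \<in> fin_below P x" "H \<inter> C = {}"
proof -
  have "\<exists>H\<in>fin_below P x. H \<inter> C = {}"
  proof (rule ccontr)
    assume "\<not> ?thesis"
    then have meets: "\<And>H. H \<in> fin_below P x \<Longrightarrow> H \<inter> C \<noteq> {}" by blast
    then obtain t where t: "t \<in> C" "\<And>G. G \<in> fin_below P x \<Longrightarrow> t \<in> up_set P G"
      using Rudin_scott_closed[OF filtered_family_fin_below[OF x(1)] C] by blast
    have "t \<in> carrier P" using t(1) scott_closed_subset[OF C] by blast
    moreover have "\<not> x \<sqsubseteq> t" using scott_closed_lower[OF C t(1)] x by blast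
    ultimately obtain G where "G \<in> fin_below P x" "t \<notin> up_set P G"
      using fin_below_separates[OF x(1)] by metis
    then show False using t(2) by blast
  qed
  then show ?thesis using that by blast
qed

text \<open>
  Interpolate \<open>H\<close> between \<open>F\<close> and \<open>x\<close>. For \<open>h\<close> in \<open>H\<close> the closed set \<open>down P h\<close> is not contained in
  the closed set of all \<open>z\<close> such that \<open>F\<close> is not way below \<open>z\<close>, so very density gives a point of \<open>S\<close>
  below \<open>h\<close> that \<open>F\<close> is way below. These points replace \<open>H\<close>.
\<close>

lemma fin_below_refine:
  assumes S: "very_dense P S" and x: "x \<in> carrier P" and F: "F \<in> fin_below P x"
  obtains G where "G \<in> fin_below P x" "G \<subseteq> S" "G \<subseteq> up_set P F"
proof -
  have F': "F \<subseteq> carrier P" "way_below P F x" using F by (auto simp: fin_below_def)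
  let ?N = "{z \<in> carrier P. \<not> way_below P F z}"
  have N: "scott_closed P ?N" by (rule scott_closed_not_way_below[OF F'(1)])
  obtain H where H: "H \<in> fin_below P x" "H \<inter> ?N = {}"
    using fin_below_avoids_closed[OF N x] F'(2) by blast
  have H': "finite H" "H \<subseteq> carrier P" "way_below P H x" using H(1) by (auto simp: fin_below_def)
  have "\<exists>s\<in>S. s \<in> carrier P \<and> s \<sqsubseteq> h \<and> way_below P F s" if h: "h \<in> H" for h
  proof -
    have "h \<in> carrier P" using h H'(2) by blast
    then have "\<not> down P h \<subseteq> ?N" using h H(2) down_subset_closed_iff[OF N] by blast
    then show ?thesis
      using very_denseD[OF S scott_closed_down N] \<open>h \<in> carrier P\<close> by (auto simp: down_def)
  qed
  then obtain r where r: "\<And>h. h \<in> H \<Longrightarrow> r h \<in> S \<and> r h \<in> carrier P \<and> r h \<sqsubseteq> h \<and> way_below P F (r h)"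
    by metis
  have G: "r ` H \<subseteq> carrier P" using r by blast
  have "H \<subseteq> up_set P (r ` H)" using r H'(2) unfolding up_set_def by blast
  then have "way_below P (r ` H) x" by (rule way_below_mono[OF partial_order_axioms G _ H'(3)])
  then have "r ` H \<in> fin_below P x" using G H'(1) by (simp add: fin_below_def)
  moreover have "r ` H \<subseteq> up_set P F" using r way_below_imp_up_set by blast
  ultimately show ?thesis using that r by blast
qed

end

text \<open>
  By \<open>fin_below_refine\<close> the finite subsets of \<open>S\<close> that are way below \<open>x\<close> are cofinal among all finite
  sets way below \<open>x\<close>, hence form a filtered family; the directed set that Rudin's lemma selects from
  their union lies in \<open>S\<close>, and its supremum, which is again in \<open>S\<close>, cannot be smaller than \<open>x\<close>.
\<close>

lemma (in dcpo) quasicontinuous_element_mem: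
  assumes lub_S: "\<And>D s. directed P D \<Longrightarrow> D \<subseteq> S \<Longrightarrow> is_lub P s D \<Longrightarrow> s \<in> S"
    and S: "very_dense P S"
    and x: "quasicontinuous_element P x"
  shows "x \<in> S"
proof -
  have xP: "x \<in> carrier P" using x by (simp add: quasicontinuous_element_def)
  let ?R = "principal_ideal P x"
  interpret R: dcpo ?R using xP by (rule dcpo_principal_ideal)
  interpret R: quasicontinuous ?R
    by unfold_locales (use x in \<open>simp add: quasicontinuous_element_def\<close>)
  have xR: "x \<in> carrier ?R" using xP by (simp add: down_def)
  have S_R: "very_dense ?R S"
    unfolding very_dense_def
    using very_denseD[OF S] scott_closed_principal_ideal_imp[OF xP] by blast
  define \<G> where "\<G> = {G \<in> fin_below ?R x. G \<subseteq> S}"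
  note refine = R.fin_below_refine[OF S_R xR]
  have filtered: "filtered_family ?R \<G>"
    unfolding filtered_family_def
  proof (intro conjI ballI)
    note fin = R.filtered_family_fin_below[OF xR]
    obtain F where "F \<in> fin_below ?R x" using fin by (auto simp: filtered_family_def)
    then obtain G where "G \<in> fin_below ?R x" "G \<subseteq> S" using refine by metis
    then show "\<G> \<noteq> {}" by (auto simp: \<G>_def)
    show "finite G" "G \<subseteq> carrier ?R" if "G \<in> \<G>" for G
      using that by (auto simp: \<G>_def fin_below_def)
    fix G1 G2 assume G12: "G1 \<in> \<G>" "G2 \<in> \<G>"
    then have "G1 \<in> fin_below ?R x" "G2 \<in> fin_below ?R x" by (auto simp: \<G>_def)
    from filtered_familyE[OF fin this] obtain F
      where F: "F \<in> fin_below ?R x" "F \<subseteq> up_set ?R G1" "F \<subseteq> up_set ?R G2" .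
    obtain G where G: "G \<in> fin_below ?R x" "G \<subseteq> S" "G \<subseteq> up_set ?R F" using refine[OF F(1)] .
    have "up_set ?R F \<subseteq> up_set ?R G1" "up_set ?R F \<subseteq> up_set ?R G2"
      using up_set_trans[OF R.partial_order_axioms] F(2,3) G12 by (auto simp: \<G>_def fin_below_def)
    then have "G \<subseteq> up_set ?R G1 \<inter> up_set ?R G2" using G(3) by blast
    then show "\<exists>G\<in>\<G>. G \<subseteq> up_set ?R G1 \<inter> up_set ?R G2" using G(1,2) unfolding \<G>_def by blast
  qed
  have meets: "\<forall>G\<in>\<G>. G \<inter> carrier ?R \<noteq> {}"
  proof
    fix G assume "G \<in> \<G>"
    then show "G \<inter> carrier ?R \<noteq> {}"
      using R.way_below_imp_up_set[OF _ xR, of G]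
      by (auto simp: \<G>_def fin_below_def up_set_def simp del: carrier_principal_ideal)
  qed
  have "\<forall>y\<in>carrier ?R. \<forall>z\<in>carrier ?R. z \<sqsubseteq>\<^bsub>?R\<^esub> y \<longrightarrow> z \<in> carrier ?R" by blast
  then obtain D where D: "directed ?R D" "D \<subseteq> carrier ?R \<inter> \<Union>\<G>" "\<And>G. G \<in> \<G> \<Longrightarrow> D \<inter> G \<noteq> {}"
    using R.Rudin[OF filtered subset_refl _ meets] by metis
  obtain s where s: "is_lub ?R s D" using R.directed_lub_exists[OF D(1)] by blast
  have s': "s \<in> carrier ?R" "\<And>d. d \<in> D \<Longrightarrow> d \<sqsubseteq> s"
    using s is_lub_iff[OF directed_carrier[OF D(1)]] by auto
  have "x \<sqsubseteq> s"
  proof (rule ccontr)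
    assume "\<not> x \<sqsubseteq> s"
    then obtain F where F: "F \<in> fin_below ?R x" "s \<notin> up_set ?R F"
      using R.fin_below_separates[OF xR s'(1)] by auto
    obtain G where G: "G \<in> fin_below ?R x" "G \<subseteq> S" "G \<subseteq> up_set ?R F"
      using refine[OF F(1)] .
    have "F \<subseteq> carrier ?R" using F(1) by (simp add: fin_below_def)
    then have "s \<notin> up_set ?R G"
      using F(2) up_set_trans[OF R.partial_order_axioms _ G(3)] by blast
    moreover obtain d where "d \<in> D" "d \<in> G" using D(3)[of G] G(1,2) by (auto simp: \<G>_def)
    ultimately show False using s' by (auto simp: up_set_def)
  qed
  then have "s = x" using s'(1) xP by (auto simp: down_def)
  moreover have "directed P D" "D \<subseteq> down P x" using D(1) by (simp_all add: directed_principal_ideal_iff)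
  moreover have "D \<subseteq> S" using D(2) by (auto simp: \<G>_def)
  moreover have "is_lub P s D"
    using s is_lub_principal_ideal_iff[OF xP \<open>directed P D\<close> \<open>D \<subseteq> down P x\<close>] by simp
  ultimately show ?thesis using lub_S by blast
qed


section \<open>Faithfulness\<close>

text \<open>
  Joins of Scott closed sets are unions, so a join-preserving injection reflects and preserves
  inclusion, which is equality of \<open>A \<union> B\<close> and \<open>B\<close>.
\<close>

lemma lattice_isomorphic_imp_order_iso:
  assumes "dcpo P" "dcpo Q"
    and iso: "lattice_isomorphic (scott_closed_lattice P) (scott_closed_lattice Q)"
  obtains h where "order_iso (scott_closed_lattice Q) (scott_closed_lattice P) h"
proof -
  let ?CP = "scott_closed_lattice P" and ?CQ = "scott_closed_lattice Q"
  interpret P: dcpo P by fact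
  interpret Q: dcpo Q by fact
  obtain f where f: "bij_betw f (carrier ?CP) (carrier ?CQ)"
    and join: "\<And>A B. A \<in> carrier ?CP \<Longrightarrow> B \<in> carrier ?CP \<Longrightarrow>
      f (A \<squnion>\<^bsub>?CP\<^esub> B) = f A \<squnion>\<^bsub>?CQ\<^esub> f B"
    using iso unfolding lattice_isomorphic_def by blast
  have f_closed: "scott_closed Q (f A)" if "scott_closed P A" for A
    using f that unfolding bij_betw_def by auto
  have f_le: "f A \<subseteq> f B \<longleftrightarrow> A \<subseteq> B" if AB: "scott_closed P A" "scott_closed P B" for A B
  proof -
    have "f (A \<union> B) = f A \<union> f B"
      using join[of A B] AB f_closed P.join_scott_closed_lattice Q.join_scott_closed_lattice by simp
    moreover have "f (A \<union> B) = f B \<longleftrightarrow> A \<union> B = B"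
      using f AB P.scott_closed_Un[OF AB] unfolding bij_betw_def inj_on_def by auto
    ultimately show ?thesis by blast
  qed
  let ?h = "inv_into (carrier ?CP) f"
  have "order_iso ?CQ ?CP ?h"
  proof
    show "bij_betw ?h (carrier ?CQ) (carrier ?CP)" using f by (rule bij_betw_inv_into)
    fix A B assume AB: "A \<in> carrier ?CQ" "B \<in> carrier ?CQ"
    have "?h A \<in> carrier ?CP" "?h B \<in> carrier ?CP"
      using bij_betw_apply[OF bij_betw_inv_into[OF f]] AB by blast+
    moreover have "f (?h A) = A" "f (?h B) = B"
      using bij_betw_inv_into_right[OF f] AB by blast+
    ultimately show "?h A \<sqsubseteq>\<^bsub>?CP\<^esub> ?h B \<longleftrightarrow> A \<sqsubseteq>\<^bsub>?CQ\<^esub> B"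
      using f_le[of "?h A" "?h B"] by simp
  qed
  then show ?thesis using that by blast
qed

theorem theorem3p16:
  fixes P :: "'a gorder"
  assumes "dcpo P"
    and "property_M P"
    and "\<forall>x\<in>carrier P. \<exists>D. directed P D \<and> (\<forall>d\<in>D. quasicontinuous_element P d) \<and> is_lub P x D"
  shows "SCL_faithful TYPE('b) P"
  unfolding SCL_faithful_def
proof (intro allI impI)
  fix Q :: "'b gorder"
  assume "dcpo Q" and iso: "lattice_isomorphic (scott_closed_lattice P) (scott_closed_lattice Q)"
  let ?CP = "scott_closed_lattice P" and ?CQ = "scott_closed_lattice Q"
  interpret P: dcpo P by fact
  interpret Q: dcpo Q by fact
  obtain h where "order_iso ?CQ ?CP h"
    using lattice_isomorphic_imp_order_iso[OF \<open>dcpo P\<close> \<open>dcpo Q\<close> iso] .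
  then interpret h: order_iso ?CQ ?CP h .
  have h_le: "h A \<subseteq> h B \<longleftrightarrow> A \<subseteq> B" if "scott_closed Q A" "scott_closed Q B" for A B
    using h.le_iff that by simp
  have h_onto: "\<exists>B. scott_closed Q B \<and> h B = A" if "scott_closed P A" for A
  proof -
    have "A \<in> h ` carrier ?CQ" using h.image_carrier that by simp
    then show ?thesis by auto
  qed
  have "\<exists>p\<in>carrier P. h (down Q q) = down P p" if q: "q \<in> carrier Q" for q
    by (rule P.C_compact_imp_principal[OF \<open>property_M P\<close> h.C_compact_image[OF Q.C_compact_down[OF q]]])
  then obtain g where g: "\<And>q. q \<in> carrier Q \<Longrightarrow> g q \<in> carrier P \<and> h (down Q q) = down P (g q)"
    by metis
  have g_le: "g q \<sqsubseteq>\<^bsub>P\<^esub> g r \<longleftrightarrow> q \<sqsubseteq>\<^bsub>Q\<^esub> r" if "q \<in> carrier Q" "r \<in> carrier Q" for q r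
    using h_le[of "down Q q" "down Q r"] that g P.down_subset_iff Q.down_subset_iff
    by (simp add: Q.scott_closed_down)
  define S where "S = g ` carrier Q"
  \<comment> \<open>The preimage of \<open>D\<close> under \<open>g\<close> has a supremum \<open>t\<close> in \<open>Q\<close>; as \<open>h\<close> preserves suprema of principal
    ideals, \<open>g t\<close> is the supremum of \<open>D\<close>.\<close>
  have lub_S: "s \<in> S" if D: "directed P D" "D \<subseteq> S" "is_lub P s D" for D s
  proof -
    define E where "E = {q \<in> carrier Q. g q \<in> D}"
    have img: "g ` E = D" using D(2) by (auto simp: E_def S_def)
    have E_sub: "E \<subseteq> carrier Q" by (auto simp: E_def)
    have E: "directed Q E"
      unfolding directed_def
    proof (intro conjI ballI E_sub)
      show "E \<noteq> {}" using img D(1) by (auto simp: directed_def)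
      fix q r assume qr: "q \<in> E" "r \<in> E"
      then have "g q \<in> D" "g r \<in> D" by (auto simp: E_def)
      from directedE[OF D(1) this] obtain z where z: "z \<in> D" "g q \<sqsubseteq>\<^bsub>P\<^esub> z" "g r \<sqsubseteq>\<^bsub>P\<^esub> z" .
      obtain e where e: "e \<in> E" "z = g e" using z(1) img by blast
      have "q \<sqsubseteq>\<^bsub>Q\<^esub> e" "r \<sqsubseteq>\<^bsub>Q\<^esub> e"
        using z(2,3) e qr E_sub by (auto simp: g_le subsetD)
      then show "\<exists>z\<in>E. q \<sqsubseteq>\<^bsub>Q\<^esub> z \<and> r \<sqsubseteq>\<^bsub>Q\<^esub> z" using e(1) by blast
    qed
    obtain t where t: "is_lub Q t E" using Q.directed_lub_exists[OF E] by blast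
    have tQ: "t \<in> carrier Q" using t by blast
    have "h (down Q e) = down P (g e)" if "e \<in> E" for e using g that E_sub by blast
    then have image: "h ` down Q ` E = down P ` D" by (simp add: image_image flip: img)
    have "down Q ` E \<subseteq> carrier ?CQ" by (rule directed_carrier[OF Q.is_lub_down(1)[OF E t]])
    moreover have "down Q t \<in> carrier ?CQ" using Q.scott_closed_down[OF tQ] by simp
    ultimately have "is_lub ?CP (h (down Q t)) (h ` down Q ` E)"
      using h.is_lub_image_iff Q.is_lub_down(2)[OF E t] by blast
    then have "is_lub ?CP (down P (g t)) (down P ` D)" using g[OF tQ] image by simp
    moreover have "is_lub ?CP (down P s) (down P ` D)" by (rule P.is_lub_down[OF D(1,3)])
    ultimately have "down P (g t) = down P s"
      by (rule partial_order.least_unique[OF partial_order_scott_closed_lattice])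
    moreover have "s \<in> carrier P" "g t \<in> carrier P" using D(3) g tQ by blast+
    ultimately have "g t = s" using P.down_subset_iff by (metis P.le_antisym order_refl)
    then show "s \<in> S" using tQ by (auto simp: S_def)
  qed
  \<comment> \<open>A point \<open>q\<close> lies in a closed set \<open>C\<close> of \<open>Q\<close> just if \<open>g q\<close> lies in \<open>h C\<close>, so every difference of
    closed sets of \<open>P\<close> can be tested on \<open>S\<close>.\<close>
  have dense: "very_dense P S"
    unfolding very_dense_def
  proof (intro allI impI, elim conjE)
    fix A B assume AB: "scott_closed P A" "scott_closed P B" "\<not> A \<subseteq> B"
    obtain A' B' where A'B': "scott_closed Q A'" "h A' = A" "scott_closed Q B'" "h B' = B"
      using h_onto AB(1,2) by blast
    then obtain q where q: "q \<in> A'" "q \<notin> B'" using h_le AB(3) by blast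
    then have qQ: "q \<in> carrier Q" using scott_closed_subset[OF A'B'(1)] by blast
    have mem_iff: "q \<in> C \<longleftrightarrow> g q \<in> h C" if C: "scott_closed Q C" "scott_closed P (h C)" for C
      using h_le[OF Q.scott_closed_down[OF qQ] C(1)] g[OF qQ]
        Q.down_subset_closed_iff[OF C(1) qQ] P.down_subset_closed_iff[OF C(2)] by simp
    have "g q \<in> A - B" using mem_iff[of A'] mem_iff[of B'] q A'B' AB by simp
    then show "\<exists>s\<in>S. s \<in> A - B" using qQ by (auto simp: S_def)
  qed
  have "x \<in> S" if x: "x \<in> carrier P" for x
  proof -
    obtain D where D: "directed P D" "\<forall>d\<in>D. quasicontinuous_element P d" "is_lub P x D"
      using assms(3) x by blast
    have "d \<in> S" if "d \<in> D" for d
    proof (rule P.quasicontinuous_element_mem[OF _ dense])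
      show "s \<in> S" if "directed P E" "E \<subseteq> S" "is_lub P s E" for E s by (rule lub_S[OF that])
      show "quasicontinuous_element P d" using D(2) that by blast
    qed
    then have "D \<subseteq> S" by blast
    then show ?thesis by (rule lub_S[OF D(1) _ D(3)])
  qed
  then have onto: "g ` carrier Q = carrier P" using g by (auto simp: S_def)
  have inj: "inj_on g (carrier Q)"
  proof (rule inj_onI)
    fix q r assume qr: "q \<in> carrier Q" "r \<in> carrier Q" "g q = g r"
    then have "g q \<sqsubseteq>\<^bsub>P\<^esub> g r" "g r \<sqsubseteq>\<^bsub>P\<^esub> g q" using g by auto
    then have "q \<sqsubseteq>\<^bsub>Q\<^esub> r" "r \<sqsubseteq>\<^bsub>Q\<^esub> q" using g_le qr(1,2) by blast+
    then show "q = r" using qr(1,2) by (rule Q.le_antisym)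
  qed
  let ?k = "inv_into (carrier Q) g"
  have "bij_betw ?k (carrier P) (carrier Q)"
    using bij_betw_inv_into[of g "carrier Q" "carrier P"] inj onto by (simp add: bij_betw_def)
  moreover have "order_emb P Q ?k"
    unfolding order_emb_def
  proof (intro conjI ballI P.weak_partial_order_axioms Q.weak_partial_order_axioms)
    fix x y assume "x \<in> carrier P" "y \<in> carrier P"
    then obtain q r where "q \<in> carrier Q" "r \<in> carrier Q" "x = g q" "y = g r" using onto by blast
    then show "?k x \<sqsubseteq>\<^bsub>Q\<^esub> ?k y \<longleftrightarrow> x \<sqsubseteq>\<^bsub>P\<^esub> y" using g_le inj by simp
  qed
  ultimately show "order_isomorphic P Q" unfolding order_isomorphic_def by blast
qed

end
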